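(* Consider the single-cone SOCO pair with feasible sets $\mathcal F_P,\mathcal F_D$, and the SDO pair $(\mathcal P^P_{SDO})$, $(\mathcal D^P_{SDO})$ (defined in the context) with feasible sets $\mathcal F_P^{SDO}$ (of $X$) and $\mathcal F_D^{SDO}$ (of $(v,w,u,S)$). Define the point-to-set mapping $\mathcal M$ sending $(\bar x,\bar y,\bar s)\in\mathcal F_P\times\mathcal F_D$ to all $(X,v,w,u,S)$ with $X=\mathrm{Arw}(\bar x)$, $v=\bar y$, and $$S=\begin{bmatrix}\frac{\bar s_1}{n}-\sum_{k=2}^nu_k&\frac{\bar s_2}{2}&\cdots&\cdots&\frac{\bar s_n}{2}\\ \frac{\bar s_2}{2}&\frac{\bar s_1}{n}+u_2&-w_{23}&\cdots&-w_{2n}\\ \vdots&-w_{23}&\frac{\bar s_1}{n}+u_3&\ddots&\vdots\\ \vdots&\vdots&\ddots&\ddots&-w_{(n-1)n}\\ \frac{\bar s_n}{2}&-w_{2n}&\cdots&-w_{(n-1)n}&\frac{\bar s_1}{n}+u_n\end{bmatrix},$$ where $w=(w_{hl})_{2\le h<l\le n}\in\mathbb R^{(n-1)(n-2)/2}$ and $u=(u_k)_{2\le k\le n}\in\mathbb R^{n-1}$ take any values such that $S\succeq0$. Let the inverse mapping $\mathcal M^{-1}$ send $(X,v,w,u,S)\in\mathcal F_P^{SDO}\times\mathcal F_D^{SDO}$ to $(\bar x,\bar y,\bar s)$ with $$\bar x=\mathrm{Arw}^{-1}(X),\qquad \bar y=v,\qquad \bar s_j=c_j-\sum_{i=1}^mv_ia_{ij}\quad(j=1,\dots,n).$$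 Then $\mathcal M$, with inverse mapping $\mathcal M^{-1}$, is a point-to-set admissible mapping.
   Context: Data: $A=(a_{ij})\in\mathbb R^{m\times n}$, $b\in\mathbb R^m$, $c\in\mathbb R^n$. $\mathcal L^n=\{x\in\mathbb R^n:x_1\ge\|x_{2:n}\|_2\}$, $x_{2:n}=(x_2,\dots,x_n)$. $\mathrm{Arw}(x)=\begin{pmatrix}x_1&x_{2:n}^T\\ x_{2:n}&x_1I_{n-1}\end{pmatrix}$, and $\mathrm{Arw}^{-1}$ recovers $x$ from $\mathrm{Arw}(x)$. SOCO pair: $\min\{c^T\bar x:A\bar x=b,\ \bar x\in\mathcal L^n\}$ and $\max\{b^T\bar y:A^T\bar y+\bar s=c,\ \bar s\in\mathcal L^n\}$. SDO data: $\vec{\mathtt C}=\mathrm{Arw}(\frac1nc_1,\frac12c_2,\dots,\frac12c_n)$, $\vec{\mathtt A}_i=\mathrm{Arw}(\frac1na_{i1},\frac12a_{i2},\dots,\frac12a_{in})$ for $i=1,\dots,m$. For $2\le h<l\le n$, $\check{\mathtt A}_{hl}$ is the symmetric matrix with entries $1$ at $(h,l)$ and $(l,h)$ and zeros elsewhere. For $k=2,\dots,n$, $\hat{\mathtt A}_k$ has entry $1$ at $(1,1)$, $-1$ at $(k,k)$ and zeros elsewhere. $(\mathcal P^P_{SDO})$: $\min\mathrm{Tr}(\vec{\mathtt C}X)$ subject to $\mathrm{Tr}(\vec{\mathtt A}_iX)=b_i$ ($i=1,\dots,m$), $\mathrm{Tr}(\check{\mathtt A}_{hl}X)=0$ ($2\le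 h<l\le n$), $\mathrm{Tr}(\hat{\mathtt A}_kX)=0$ ($k=2,\dots,n$), $X\succeq0$ (so feasible $X$ are arrow-head). $(\mathcal D^P_{SDO})$: $\max b^Tv$ subject to $\sum_{i=1}^mv_i\vec{\mathtt A}_i+\sum_{2\le h<l\le n}w_{hl}\check{\mathtt A}_{hl}+\sum_{k=2}^nu_k\hat{\mathtt A}_k+S=\vec{\mathtt C}$, $S\succeq0$. $X,S$ are real symmetric $n\times n$ matrices. Admissible: $\mathcal M$ with inverse mapping $\mathcal M^{-1}$ is admissible if it preserves feasibility and objective values, i.e. points of $\mathcal F_P\times\mathcal F_D$ are mapped by $\mathcal M$ into $\mathcal F_P^{SDO}\times\mathcal F_D^{SDO}$ (for a point-to-set map: every element of the image is feasible); points of $\mathcal F_P^{SDO}\times\mathcal F_D^{SDO}$ are mapped by $\mathcal M^{-1}$ into $\mathcal F_P\times\mathcal F_D$; and $c^T\bar x=\mathrm{Tr}(\vec{\mathtt C}X)$, $b^T\bar y=b^Tv$ for corresponding points. *)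

theory Defs
  imports "HOL-Analysis.Analysis"
begin

text \<open>
  The coordinates \<open>1, \<dots>, n\<close> are the elements of a finite linearly ordered type \<open>'n\<close>, with
  \<open>n = CARD('n)\<close>. Coordinate 1 is the least element \<open>ix1\<close>, and \<open>2 \<le> k\<close> is \<open>ix1 < k\<close>.
  The constraint rows \<open>1, \<dots>, m\<close> are the elements of a finite type \<open>'m\<close>.
\<close>

type_synonym 'n rvec = "(real, 'n) vec"

type_synonym ('m, 'n) rmat = "('n rvec, 'm) vec"

definition ix1 :: "'n::{finite,linorder}" where
  "ix1 = Min UNIV"

definition ix_pairs :: "('n::{finite,linorder} \<times> 'n) set" where
  "ix_pairs = {(h, l). ix1 < h \<and> h < l}"

definition lorentz_cone :: "('n::{finite,linorder} rvec) set" where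
  "lorentz_cone = {x. x $ ix1 \<ge> L2_set (\<lambda>j. x $ j) {ix1<..}}"

definition Arw :: "'n::{finite,linorder} rvec \<Rightarrow> ('n,'n) rmat" where
  "Arw x = (\<chi> i j. if i = j then x $ ix1
                   else if i = ix1 then x $ j
                   else if j = ix1 then x $ i
                   else 0)"

definition psd :: "('n::{finite,linorder},'n) rmat \<Rightarrow> bool" where
  "psd X \<longleftrightarrow> transpose X = X \<and> (\<forall>z. 0 \<le> z \<bullet> (X *v z))"


subsection \<open>The SOCO pair\<close>

definition soco_primal_feasible ::
    "('m::finite,'n) rmat \<Rightarrow> 'm rvec \<Rightarrow> ('n::{finite,linorder} rvec) set" where
  "soco_primal_feasible A b = {x. A *v x = b \<and> x \<in> lorentz_cone}"

definition soco_dual_feasible ::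
    "('m::finite,'n) rmat \<Rightarrow> 'n::{finite,linorder} rvec \<Rightarrow> ('m rvec \<times> 'n rvec) set" where
  "soco_dual_feasible A c = {(y, s). transpose A *v y + s = c \<and> s \<in> lorentz_cone}"


subsection \<open>The SDO pair\<close>

definition arw_data :: "'n::{finite,linorder} rvec \<Rightarrow> ('n,'n) rmat" where
  "arw_data a = Arw (\<chi> j. if j = ix1 then (1 / real CARD('n)) * a $ j else (1 / 2) * a $ j)"

definition check_A :: "'n::{finite,linorder} \<Rightarrow> 'n \<Rightarrow> ('n,'n) rmat" where
  "check_A h l = (\<chi> i j. if (i, j) = (h, l) \<or> (i, j) = (l, h) then 1 else 0)"

definition hat_A :: "'n::{finite,linorder} \<Rightarrow> ('n,'n) rmat" where
  "hat_A k = (\<chi> i j. if (i, j) = (ix1, ix1) then 1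
                     else if (i, j) = (k, k) then - 1
                     else 0)"

definition sdo_primal_feasible ::
    "('m::finite,'n) rmat \<Rightarrow> 'm rvec \<Rightarrow> (('n::{finite,linorder},'n) rmat) set" where
  "sdo_primal_feasible A b =
     {X. (\<forall>i. trace (arw_data (A $ i) ** X) = b $ i) \<and>
         (\<forall>(h, l)\<in>ix_pairs. trace (check_A h l ** X) = 0) \<and>
         (\<forall>k>ix1. trace (hat_A k ** X) = 0) \<and>
         psd X}"

text \<open>
  The multiplier vectors \<open>w\<close> and \<open>u\<close>, with \<open>(n-1)(n-2)/2\<close> and \<open>n-1\<close> entries, are functions on
  \<open>ix_pairs\<close> and \<open>{ix1<..}\<close>; \<^const>\<open>extensional\<close> fixes their irrelevant values elsewhere, so that
  each multiplier vector is represented by exactly one function.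
\<close>

type_synonym ('m, 'n) sdo_dual =
  "'m rvec \<times> ('n \<times> 'n \<Rightarrow> real) \<times> ('n \<Rightarrow> real) \<times> ('n, 'n) rmat"

definition sdo_dual_feasible ::
    "('m::finite,'n) rmat \<Rightarrow> 'n::{finite,linorder} rvec \<Rightarrow>
     ('m,'n) sdo_dual set" where
  "sdo_dual_feasible A c =
     {(v, w, u, S).
        w \<in> extensional ix_pairs \<and> u \<in> extensional {ix1<..} \<and>
        (\<Sum>i\<in>UNIV. v $ i *\<^sub>R arw_data (A $ i))
          + (\<Sum>(h, l)\<in>ix_pairs. w (h, l) *\<^sub>R check_A h l)
          + (\<Sum>k\<in>{ix1<..}. u k *\<^sub>R hat_A k)
          + S = arw_data c \<and>
        psd S}"


subsection \<open>The mappings\<close>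

definition slack_matrix ::
    "'n::{finite,linorder} rvec \<Rightarrow> ('n \<times> 'n \<Rightarrow> real) \<Rightarrow> ('n \<Rightarrow> real) \<Rightarrow> ('n,'n) rmat" where
  "slack_matrix s w u =
     (\<chi> i j. if i = ix1 \<and> j = ix1 then s $ ix1 / real CARD('n) - (\<Sum>k\<in>{ix1<..}. u k)
             else if i = ix1 then s $ j / 2
             else if j = ix1 then s $ i / 2
             else if i = j then s $ ix1 / real CARD('n) + u i
             else if i < j then - w (i, j)
             else - w (j, i))"

definition soco_to_sdo ::
    "'n::{finite,linorder} rvec \<times> 'm::finite rvec \<times> 'n rvec \<Rightarrow>
     (('n,'n) rmat \<times> ('m,'n) sdo_dual) set" where
  "soco_to_sdo = (\<lambda>(x, y, s).
     {(X, v, w, u, S).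
        X = Arw x \<and> v = y \<and>
        w \<in> extensional ix_pairs \<and> u \<in> extensional {ix1<..} \<and>
        S = slack_matrix s w u \<and> psd S})"

definition sdo_to_soco ::
    "('m::finite,'n) rmat \<Rightarrow> 'n::{finite,linorder} rvec \<Rightarrow>
     ('n,'n) rmat \<times> ('m,'n) sdo_dual \<Rightarrow>
     'n rvec \<times> 'm rvec \<times> 'n rvec" where
  "sdo_to_soco A c = (\<lambda>(X, v, w, u, S).
     (inv Arw X, v, \<chi> j. c $ j - (\<Sum>i\<in>UNIV. v $ i * A $ i $ j)))"


subsection \<open>Admissibility\<close>

text \<open>
  \<open>N\<close> is the inverse mapping of the point-to-set mapping \<open>M\<close> between \<open>F\<close> and \<open>G\<close>: composing
  either one after the other leads back to the starting point.
\<close>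

definition inverse_mapping :: "'a set \<Rightarrow> 'b set \<Rightarrow> ('a \<Rightarrow> 'b set) \<Rightarrow> ('b \<Rightarrow> 'a) \<Rightarrow> bool" where
  "inverse_mapping F G M N \<longleftrightarrow> (\<forall>z\<in>F. N ` M z = {z}) \<and> (\<forall>Z\<in>G. Z \<in> M (N Z))"

text \<open>
  \<open>FP\<close>, \<open>FD\<close>, \<open>fP\<close>, \<open>fD\<close> are the primal and dual feasible sets and objective functions of the first
  pair of problems, \<open>GP\<close>, \<open>GD\<close>, \<open>gP\<close>, \<open>gD\<close> those of the second. Points \<open>z\<close> and \<open>Z\<close>
  correspond if \<open>M\<close> may send \<open>z\<close> to \<open>Z\<close> or \<open>N\<close> sends \<open>Z\<close> to \<open>z\<close>.
\<close>

definition admissible ::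
    "'p set \<Rightarrow> 'd set \<Rightarrow> ('p \<Rightarrow> real) \<Rightarrow> ('d \<Rightarrow> real) \<Rightarrow>
     'q set \<Rightarrow> 'e set \<Rightarrow> ('q \<Rightarrow> real) \<Rightarrow> ('e \<Rightarrow> real) \<Rightarrow>
     ('p \<times> 'd \<Rightarrow> ('q \<times> 'e) set) \<Rightarrow> ('q \<times> 'e \<Rightarrow> 'p \<times> 'd) \<Rightarrow> bool" where
  "admissible FP FD fP fD GP GD gP gD M N \<longleftrightarrow>
     (\<forall>z \<in> FP \<times> FD. M z \<subseteq> GP \<times> GD) \<and>
     (\<forall>Z \<in> GP \<times> GD. N Z \<in> FP \<times> FD) \<and>
     (\<forall>z \<in> FP \<times> FD. \<forall>Z \<in> GP \<times> GD. Z \<in> M z \<or> z = N Z \<longrightarrow>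
        fP (fst z) = gP (fst Z) \<and> fD (snd z) = gD (snd Z))"

end

theory Submission
  imports Defs
begin

text \<open>
  The constraints \<open>check_A\<close> and \<open>hat_A\<close> force a feasible \<open>X\<close> to be an arrow matrix, and
  \<open>Arw x\<close> is positive semidefinite iff \<open>x\<close> lies in the cone. Dually, an admissible \<open>S\<close> with
  slack \<open>s\<close> is exactly a symmetric matrix with trace \<open>s\<^sub>1\<close> and first row \<open>s\<^sub>j / 2\<close> off the
  diagonal; a positive semidefinite matrix of this kind exists iff \<open>s\<close> lies in the cone.
\<close>

section \<open>Splitting off the first coordinate; the norm of the remaining ones\<close>

lemma ix1_le [simp]: "ix1 \<le> (i::'n::{finite,linorder})"
  by (simp add: ix1_def)

lemma not_less_ix1 [simp]: "\<not> (i::'n::{finite,linorder}) < ix1"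
  by (simp add: not_less)

lemma ix1_less_iff: "ix1 < (i::'n::{finite,linorder}) \<longleftrightarrow> i \<noteq> ix1"
  using ix1_le[of i] by (metis order_less_le)

lemma UNIV_ix1: "(UNIV::'n::{finite,linorder} set) = insert ix1 {ix1<..}"
  by (auto simp: ix1_less_iff)

lemma sum_UNIV_ix1:
  "(\<Sum>i\<in>(UNIV::'n::{finite,linorder} set). f i) = f ix1 + (\<Sum>i\<in>{ix1<..}. f i)"
  unfolding UNIV_ix1 by (subst sum.insert) auto

lemma card_ix1: "real CARD('n::{finite,linorder}) = 1 + real (card {ix1::'n<..})"
  using sum_UNIV_ix1[of "\<lambda>_::'n. 1::real"] by simp

lemma mem_ix_pairs: "(i, j) \<in> ix_pairs \<longleftrightarrow> ix1 < i \<and> i < j"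
  by (simp add: ix_pairs_def)

text \<open>The diagonals of \<open>arw_data\<close> and \<open>slack_matrix\<close> spread a first
  coordinate over n equal shares; this identity collects them again.\<close>

lemma divide_card_ix1:
  "a / real CARD('n::{finite,linorder}) + real (card {ix1::'n<..}) * (a / real CARD('n)) = a"
proof -
  have "a / real CARD('n) + real (card {ix1::'n<..}) * (a / real CARD('n)) = real CARD('n) * (a / real CARD('n))"
    by (subst (3) card_ix1) (simp only: distrib_right mult_1)
  then show ?thesis by simp
qed

definition tail_norm :: "'n::{finite,linorder} rvec \<Rightarrow> real" where
  "tail_norm x = L2_set (\<lambda>j. x $ j) {ix1<..}"

lemma tail_norm_nonneg [simp]: "0 \<le> tail_norm x"
  by (simp add: tail_norm_def)

lemma tail_norm_square: "(\<Sum>j\<in>{ix1<..}. (x $ j)\<^sup>2) = (tail_norm x)\<^sup>2"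
  unfolding tail_norm_def L2_set_def by (simp add: sum_nonneg)

lemma tail_norm_eq_0_iff: "tail_norm x = 0 \<longleftrightarrow> (\<forall>j>ix1. x $ j = 0)"
  unfolding tail_norm_def by (subst L2_set_eq_0_iff) auto

lemma lorentz_cone_iff: "x \<in> lorentz_cone \<longleftrightarrow> tail_norm x \<le> x $ ix1"
  by (simp add: lorentz_cone_def tail_norm_def)

section \<open>Quadratic forms of symmetric matrices\<close>

lemma quadratic_form_expand:
  "z \<bullet> (X *v z) = (\<Sum>i\<in>UNIV. \<Sum>j\<in>UNIV. X $ i $ j * (z $ i * z $ j))"
  for X :: "('n::finite, 'n) rmat"
  by (simp add: inner_vec_def matrix_vector_mult_def sum_distrib_left mult.left_commute)

lemma psd_symmetric:
  assumes "psd X"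
  shows "X $ j $ i = X $ i $ j"
proof -
  have "transpose X $ i $ j = X $ i $ j"
    using assms by (simp only: psd_def)
  then show ?thesis by (simp add: transpose_def)
qed

text \<open>Block form with respect to the first coordinate: by symmetry the first row and the first
  column contribute equally, hence the factor 2 in the cross term.\<close>

lemma quadratic_form_ix1:
  assumes sym: "\<And>i j. X $ j $ i = X $ i $ j"
  shows "z \<bullet> (X *v z) = X $ ix1 $ ix1 * (z $ ix1)\<^sup>2
    + 2 * z $ ix1 * (\<Sum>j\<in>{ix1<..}. X $ ix1 $ j * z $ j)
    + (\<Sum>i\<in>{ix1<..}. \<Sum>j\<in>{ix1<..}. X $ i $ j * (z $ i * z $ j))"
proof -
  have "(\<Sum>i\<in>{ix1<..}. X $ i $ ix1 * (z $ i * z $ ix1)) = z $ ix1 * (\<Sum>j\<in>{ix1<..}. X $ ix1 $ j * z $ j)"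
    by (simp add: sum_distrib_left sym[of _ ix1] algebra_simps)
  moreover have "(\<Sum>j\<in>{ix1<..}. X $ ix1 $ j * (z $ ix1 * z $ j)) = z $ ix1 * (\<Sum>j\<in>{ix1<..}. X $ ix1 $ j * z $ j)"
    by (simp add: sum_distrib_left algebra_simps)
  ultimately show ?thesis
    by (simp add: quadratic_form_expand sum_UNIV_ix1 sum.distrib power2_eq_square)
qed

section \<open>Arrow matrices and the Lorentz cone\<close>

lemma Arw_nth [simp]:
  "Arw x $ i $ i = x $ ix1"
  "Arw x $ ix1 $ j = x $ j"
  "Arw x $ j $ ix1 = x $ j"
  "i \<noteq> j \<Longrightarrow> i \<noteq> ix1 \<Longrightarrow> j \<noteq> ix1 \<Longrightarrow> Arw x $ i $ j = 0"
  by (auto simp: Arw_def)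

lemma inj_Arw: "inj Arw"
  by (rule injI) (metis Arw_nth(2) vec_eq_iff)

lemma Arw_symmetric: "Arw x $ j $ i = Arw x $ i $ j"
  by (auto simp: Arw_def)

text \<open>Away from its first row and column \<open>Arw x\<close> is a multiple of the identity,
  so the double sum in \<open>quadratic_form_ix1\<close> collapses to its diagonal.\<close>

lemma Arw_quadratic_form:
  "z \<bullet> (Arw x *v z) = x $ ix1 * ((z $ ix1)\<^sup>2 + (tail_norm z)\<^sup>2)
     + 2 * z $ ix1 * (\<Sum>j\<in>{ix1<..}. x $ j * z $ j)"
proof -
  have "(\<Sum>j\<in>{ix1<..}. Arw x $ i $ j * (z $ i * z $ j)) = x $ ix1 * (z $ i)\<^sup>2"
    if "i \<in> {ix1<..}" for i
  proof -
    have "(\<Sum>j\<in>{ix1<..}. Arw x $ i $ j * (z $ i * z $ j)) =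
          (\<Sum>j\<in>{ix1<..}. if j = i then x $ ix1 * (z $ i)\<^sup>2 else 0)"
      using that by (intro sum.cong) (auto simp: power2_eq_square)
    then show ?thesis using that by simp
  qed
  then show ?thesis
    by (simp add: quadratic_form_ix1[OF Arw_symmetric] tail_norm_square[symmetric]
        sum_distrib_left algebra_simps)
qed

text \<open>Necessity comes from one test vector on which Cauchy-Schwarz is tight, sufficiency from
  Cauchy-Schwarz on the tails followed by completing a square.\<close>

lemma psd_Arw_iff: "psd (Arw x) \<longleftrightarrow> x \<in> lorentz_cone"
proof
  assume psd: "psd (Arw x)"
  let ?r = "tail_norm x"
  \<comment> \<open>With r the tail norm of \<open>x\<close>, the quadratic form at this vector is 2
    r^2 (x_1 - r).\<close>
  define z where "z = (\<chi> j. if j = ix1 then - ?r else x $ j)"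
  have z1: "z $ ix1 = - ?r" by (simp add: z_def)
  have zt: "(\<Sum>j\<in>{ix1<..}. (z $ j)\<^sup>2) = ?r\<^sup>2" "(\<Sum>j\<in>{ix1<..}. x $ j * z $ j) = ?r\<^sup>2"
    unfolding tail_norm_square[symmetric]
    by (auto simp: z_def power2_eq_square intro!: sum.cong)
  have "0 \<le> z \<bullet> (Arw x *v z)"
    using psd by (simp add: psd_def)
  then have *: "?r\<^sup>2 * ?r \<le> ?r\<^sup>2 * x $ ix1"
    using zt by (simp add: Arw_quadratic_form z1 tail_norm_square algebra_simps)
  show "x \<in> lorentz_cone"
  proof (cases "?r = 0")
    case True
    \<comment> \<open>For r = 0 the vector \<open>z\<close> vanishes and says nothing; the first
      unit vector gives the sign of x_1 instead.\<close>
    have "0 \<le> axis ix1 1 \<bullet> (Arw x *v axis ix1 1)"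
      using psd unfolding psd_def by blast
    then have "0 \<le> x $ ix1"
      by (simp add: matrix_vector_mult_basis column_def inner_axis')
    then show ?thesis using True by (simp add: lorentz_cone_iff)
  next
    case False
    then show ?thesis using * by (simp add: lorentz_cone_iff)
  qed
next
  assume "x \<in> lorentz_cone"
  then have x1: "tail_norm x \<le> x $ ix1" by (simp add: lorentz_cone_iff)
  show "psd (Arw x)"
    unfolding psd_def
  proof (intro conjI allI)
    show "transpose (Arw x) = Arw x"
      by (simp add: transpose_def vec_eq_iff Arw_symmetric)
  next
    fix z
    let ?d = "\<Sum>j\<in>{ix1<..}. x $ j * z $ j"
    have "\<bar>?d\<bar> \<le> (\<Sum>j\<in>{ix1<..}. \<bar>x $ j\<bar> * \<bar>z $ j\<bar>)"
      by (metis (no_types, lifting) abs_mult sum.cong sum_abs)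
    also have "\<dots> \<le> tail_norm x * tail_norm z"
      unfolding tail_norm_def by (rule L2_set_mult_ineq)
    also have "\<dots> \<le> x $ ix1 * tail_norm z"
      using x1 by (simp add: mult_right_mono)
    finally have "\<bar>z $ ix1\<bar> * \<bar>?d\<bar> \<le> \<bar>z $ ix1\<bar> * (x $ ix1 * tail_norm z)"
      by (simp add: mult_left_mono)
    then have "- (z $ ix1 * ?d) \<le> \<bar>z $ ix1\<bar> * (x $ ix1 * tail_norm z)"
      by (simp flip: abs_mult)
    \<comment> \<open>The square bounds twice the mixed term from the previous fact by the diagonal
      part of the form.\<close>
    moreover have "0 \<le> x $ ix1 * (\<bar>z $ ix1\<bar> - tail_norm z)\<^sup>2"
      using x1 by (meson mult_nonneg_nonneg order_trans tail_norm_nonneg zero_le_power2)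
    ultimately show "0 \<le> z \<bullet> (Arw x *v z)"
      by (simp add: Arw_quadratic_form power2_diff algebra_simps)
  qed
qed

section \<open>Slack matrices and the Lorentz cone\<close>

text \<open>
  Up to the factor \<open>tail_norm s\<close>, the boundary point \<open>(tail_norm s, -s\<^sub>2, \<dots>, -s\<^sub>n)\<close> of the cone has
  an arrow matrix that is the sum of one dyad and, by Lagrange's identity, of the dyads of
  \<open>s\<^sub>i e\<^sub>j - s\<^sub>j e\<^sub>i\<close>. Testing \<open>S\<close> on these vectors therefore avoids the spectral theorem.
\<close>
lemma psd_imp_lorentz_cone:
  assumes psd: "psd S"
    and row: "\<And>j. ix1 < j \<Longrightarrow> S $ ix1 $ j = s $ j / 2"
    and tr: "trace S = s $ ix1"
  shows "s \<in> lorentz_cone"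
proof -
  let ?r = "tail_norm s" and ?T = "{ix1<..}"
  let ?D = "\<Sum>j\<in>?T. S $ j $ j" and ?Q = "\<Sum>i\<in>?T. \<Sum>j\<in>?T. S $ i $ j * (s $ i * s $ j)"
  have sym: "S $ j $ i = S $ i $ j" for i j
    using psd by (rule psd_symmetric)
  have nonneg: "0 \<le> z \<bullet> (S *v z)" for z
    using psd by (simp add: psd_def)
  have diag: "0 \<le> S $ i $ i" for i
    using nonneg[of "axis i 1"] by (simp add: matrix_vector_mult_basis column_def inner_axis')
  have s1: "s $ ix1 = S $ ix1 $ ix1 + ?D"
    using tr by (simp add: trace_def sum_UNIV_ix1)
  define z where "z = (\<chi> j. if j = ix1 then - ?r else s $ j)"
  have row_sum: "(\<Sum>j\<in>?T. S $ ix1 $ j * z $ j) = ?r\<^sup>2 / 2"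
    unfolding tail_norm_square[symmetric] sum_divide_distrib
    by (intro sum.cong) (auto simp: z_def row power2_eq_square)
  have double_sum: "(\<Sum>i\<in>?T. \<Sum>j\<in>?T. S $ i $ j * (z $ i * z $ j)) = ?Q"
    by (intro sum.cong) (auto simp: z_def)
  have z1: "z $ ix1 = - ?r" by (simp add: z_def)
  have 1: "0 \<le> S $ ix1 $ ix1 * ?r\<^sup>2 - ?r * ?r\<^sup>2 + ?Q"
    using nonneg[of z] by (simp add: quadratic_form_ix1[OF sym] row_sum double_sum z1)
  have lag: "0 \<le> (s $ i)\<^sup>2 * S $ j $ j + (s $ j)\<^sup>2 * S $ i $ i - 2 * (S $ i $ j * (s $ i * s $ j))" for i j
  proof -
    have "0 \<le> (s $ i *\<^sub>R axis j 1 - s $ j *\<^sub>R axis i 1) \<bullet> (S *v (s $ i *\<^sub>R axis j 1 - s $ j *\<^sub>R axis i 1))"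
      by (rule nonneg)
    then show ?thesis
      by (simp add: matrix_vector_mult_diff_distrib matrix_vector_mult_scaleR inner_diff_left inner_diff_right
         matrix_vector_mult_basis column_def inner_axis' sym[of i j] power2_eq_square algebra_simps)
  qed
  \<comment> \<open>Summing over ordered pairs counts each inequality twice and adds the trivial
    cases \<open>i = j\<close>; the result is that \<open>?Q\<close> is at most r^2
    \<open>?D\<close>.\<close>
  have "0 \<le> (\<Sum>i\<in>?T. \<Sum>j\<in>?T. (s $ i)\<^sup>2 * S $ j $ j + S $ i $ i * (s $ j)\<^sup>2
      - 2 * (S $ i $ j * (s $ i * s $ j)))"
    by (intro sum_nonneg) (use lag in \<open>simp add: mult.commute\<close>)
  also have "\<dots> = ?r\<^sup>2 * ?D + ?r\<^sup>2 * ?D - 2 * ?Q"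
    by (simp add: sum.distrib sum_subtractf flip: tail_norm_square sum_distrib_left sum_distrib_right)
  \<comment> \<open>Replacing \<open>?Q\<close> in fact \<open>1\<close> by its bound leaves r^2
    times the trace of \<open>S\<close>, which is s_1.\<close>
  finally have "?r\<^sup>2 * ?r \<le> ?r\<^sup>2 * s $ ix1"
    using 1 by (simp add: s1 algebra_simps)
  \<comment> \<open>Needed for r = 0, where the inequality just obtained is void.\<close>
  moreover have "0 \<le> s $ ix1"
    by (auto simp: s1 intro!: add_nonneg_nonneg sum_nonneg diag)
  ultimately show ?thesis
    by (cases "?r = 0") (auto simp: lorentz_cone_iff)
qed

lemma slack_matrix_ix1 [simp]:
  "ix1 < j \<Longrightarrow> slack_matrix s w u $ ix1 $ j = s $ j / 2"
  by (simp add: slack_matrix_def)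

lemma trace_slack_matrix [simp]:
  "trace (slack_matrix s w u) = s $ ix1"
  for s :: "'n::{finite,linorder} rvec"
proof -
  have "(\<Sum>i\<in>{ix1<..}. slack_matrix s w u $ i $ i) = (\<Sum>i\<in>{ix1<..}. s $ ix1 / real CARD('n) + u i)"
    by (intro sum.cong) (auto simp: slack_matrix_def)
  moreover have "slack_matrix s w u $ ix1 $ ix1 = s $ ix1 / real CARD('n) - (\<Sum>k\<in>{ix1<..}. u k)"
    by (simp add: slack_matrix_def)
  ultimately show ?thesis
    using divide_card_ix1[of "s $ ix1", where ?'n = 'n]
    by (simp add: trace_def sum_UNIV_ix1 sum.distrib)
qed

text \<open>The multipliers parametrize the block below the first row freely: \<open>w\<close> is
  read off its upper triangle and \<open>u\<close> off its diagonal. The corner entry is then forced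
  by the trace.\<close>

lemma slack_matrix_surj:
  fixes S :: "('n::{finite,linorder}, 'n) rmat"
  assumes sym: "\<And>i j. S $ j $ i = S $ i $ j"
    and row: "\<And>j. ix1 < j \<Longrightarrow> S $ ix1 $ j = s $ j / 2"
    and tr: "trace S = s $ ix1"
  obtains w u where "w \<in> extensional ix_pairs" "u \<in> extensional {ix1<..}" "slack_matrix s w u = S"
proof
  let ?w = "restrict (\<lambda>(i, j). - S $ i $ j) ix_pairs"
  let ?u = "restrict (\<lambda>i. S $ i $ i - s $ ix1 / real CARD('n)) {ix1<..}"
  show "?w \<in> extensional ix_pairs" "?u \<in> extensional {ix1<..}" by simp_all
  have off: "slack_matrix s ?w ?u $ i $ j = S $ i $ j" if "(i, j) \<noteq> (ix1, ix1)" for i j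
    using that row[of i] row[of j] sym[of i j]
    by (auto simp: slack_matrix_def ix_pairs_def ix1_less_iff not_less)
  \<comment> \<open>The corner is compared indirectly: both matrices have the same trace and agree
    on the rest of the diagonal.\<close>
  have "trace (slack_matrix s ?w ?u) = trace S"
    by (simp add: tr)
  moreover have "(\<Sum>i\<in>{ix1<..}. slack_matrix s ?w ?u $ i $ i) = (\<Sum>i\<in>{ix1<..}. S $ i $ i)"
    by (intro sum.cong) (auto simp: off)
  ultimately have "slack_matrix s ?w ?u $ ix1 $ ix1 = S $ ix1 $ ix1"
    by (simp add: trace_def sum_UNIV_ix1)
  then have "slack_matrix s ?w ?u $ i $ j = S $ i $ j" for i j
    using off[of i j] by (cases "(i, j) = (ix1, ix1)") auto
  then show "slack_matrix s ?w ?u = S"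
    by (simp add: vec_eq_iff)
qed

text \<open>
  Witness: \<open>(1 / 2r) (r, t) (r, t)\<^sup>T + (s\<^sub>1 - r) e\<^sub>1 e\<^sub>1\<^sup>T\<close> with \<open>t = (s\<^sub>2, \<dots>, s\<^sub>n)\<close> and \<open>r\<close> the norm of \<open>t\<close>;
  for \<open>r = 0\<close> the first summand is the zero matrix, as it should be, since \<open>1 / 0 = 0\<close>.
\<close>
lemma lorentz_cone_imp_psd_slack_matrix:
  fixes s :: "'n::{finite,linorder} rvec"
  assumes "s \<in> lorentz_cone"
  obtains w u where "w \<in> extensional ix_pairs" "u \<in> extensional {ix1<..}" "psd (slack_matrix s w u)"
proof -
  let ?r = "tail_norm s"
  define p where "p = (\<chi> j. if j = ix1 then ?r else s $ j)"
  define S :: "('n, 'n) rmat" where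
    "S = (\<chi> i j. p $ i * p $ j / (2 * ?r) + (if i = ix1 \<and> j = ix1 then s $ ix1 - ?r else 0))"
  have sym: "S $ j $ i = S $ i $ j" for i j
    by (simp add: S_def mult.commute)
  have "S $ ix1 $ j = s $ j / 2" if "ix1 < j" for j
    using that tail_norm_eq_0_iff[of s] by (auto simp: S_def p_def)
  moreover have "trace S = s $ ix1"
  proof -
    have "(\<Sum>i\<in>{ix1<..}. S $ i $ i) = ?r\<^sup>2 / (2 * ?r)"
      unfolding tail_norm_square[symmetric] sum_divide_distrib
      by (intro sum.cong) (auto simp: S_def p_def power2_eq_square)
    then show ?thesis
      by (simp add: trace_def sum_UNIV_ix1) (simp add: S_def p_def power2_eq_square)
  qed
  ultimately obtain w u where wu: "w \<in> extensional ix_pairs" "u \<in> extensional {ix1<..}"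
    "slack_matrix s w u = S"
    using slack_matrix_surj[OF sym] by blast
  \<comment> \<open>The two dyads turn the form into a weighted sum of two squares; cone membership
    makes the weight s_1 - r nonnegative.\<close>
  have "z \<bullet> (S *v z) = (p \<bullet> z)\<^sup>2 / (2 * ?r) + (s $ ix1 - ?r) * (z $ ix1)\<^sup>2" for z
  proof -
    have "S *v z = ((p \<bullet> z) / (2 * ?r)) *\<^sub>R p + ((s $ ix1 - ?r) * z $ ix1) *\<^sub>R axis ix1 1"
    proof (subst vec_eq_iff, intro allI)
      fix i :: 'n
      have "(S *v z) $ i = (\<Sum>j\<in>UNIV. p $ j * z $ j * (p $ i / (2 * ?r))
          + (if j = ix1 then (if i = ix1 then (s $ ix1 - ?r) * z $ ix1 else 0) else 0))"
        unfolding matrix_vector_mult_def vec_lambda_beta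
        by (intro sum.cong) (auto simp: S_def distrib_right)
      then show "(S *v z) $ i = (((p \<bullet> z) / (2 * ?r)) *\<^sub>R p + ((s $ ix1 - ?r) * z $ ix1) *\<^sub>R axis ix1 1) $ i"
        by (simp add: sum.distrib inner_vec_def axis_def sum_distrib_right sum_divide_distrib)
    qed
    then show ?thesis
      by (simp add: inner_add_right inner_axis inner_commute power2_eq_square)
  qed
  moreover have "?r \<le> s $ ix1"
    using assms by (simp add: lorentz_cone_iff)
  ultimately have "psd S"
    unfolding psd_def transpose_def by (auto simp: vec_eq_iff sym)
  then show ?thesis
    using that wu by simp
qed

section \<open>The primal constraints\<close>

lemma trace_matrix_mult:
  "trace (B ** X) = (\<Sum>i\<in>UNIV. \<Sum>j\<in>UNIV. B $ i $ j * X $ j $ i)"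
  for B X :: "('n::finite, 'n) rmat"
  by (simp add: trace_def matrix_matrix_mult_def)

text \<open>This explains the weights in \<open>arw_data\<close>: the first product occurs n times
  on the diagonal with weight 1/n, every other product twice with weight 1/2. It serves both the
  equality constraints and the objective.\<close>

lemma trace_arw_data_Arw:
  "trace (arw_data a ** Arw x) = a \<bullet> x"
  for a :: "'n::{finite,linorder} rvec"
proof -
  let ?T = "{ix1::'n<..}" and ?d = "a $ ix1 * x $ ix1 / real CARD('n)"
  let ?f = "\<lambda>i j. arw_data a $ i $ j * Arw x $ j $ i"
  have inner: "(\<Sum>j\<in>?T. ?f i j) = ?d" if "i \<in> ?T" for i
  proof -
    have "(\<Sum>j\<in>?T. ?f i j) = (\<Sum>j\<in>?T. if j = i then ?d else 0)"
      using that by (intro sum.cong) (auto simp: arw_data_def)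
    then show ?thesis using that by simp
  qed
  have row: "(\<Sum>j\<in>?T. ?f ix1 j) = (\<Sum>j\<in>?T. a $ j * x $ j) / 2"
    unfolding sum_divide_distrib by (intro sum.cong) (auto simp: arw_data_def)
  have col: "(\<Sum>i\<in>?T. ?f i ix1) = (\<Sum>j\<in>?T. a $ j * x $ j) / 2"
    unfolding sum_divide_distrib by (intro sum.cong) (auto simp: arw_data_def)
  have "trace (arw_data a ** Arw x) =
      ?f ix1 ix1 + (\<Sum>i\<in>?T. ?f i ix1) + ((\<Sum>j\<in>?T. ?f ix1 j) + (\<Sum>i\<in>?T. \<Sum>j\<in>?T. ?f i j))"
    unfolding trace_matrix_mult sum_UNIV_ix1 sum.distrib ..
  also have "(\<Sum>i\<in>?T. \<Sum>j\<in>?T. ?f i j) = real (card ?T) * ?d"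
    using inner by simp
  also have "?f ix1 ix1 = ?d"
    by (simp add: arw_data_def)
  also have "?d + (\<Sum>i\<in>?T. ?f i ix1) + ((\<Sum>j\<in>?T. ?f ix1 j) + real (card ?T) * ?d) =
      (?d + real (card ?T) * ?d) + (\<Sum>j\<in>?T. a $ j * x $ j)"
    unfolding row col by simp
  also have "\<dots> = a \<bullet> x"
    unfolding divide_card_ix1 by (simp add: inner_vec_def sum_UNIV_ix1)
  finally show ?thesis .
qed

lemma trace_check_A:
  assumes "h \<noteq> l"
  shows "trace (check_A h l ** X) = X $ l $ h + X $ h $ l"
proof -
  have "(\<Sum>j\<in>UNIV. check_A h l $ i $ j * X $ j $ i) =
    (if i = h then X $ l $ h else 0) + (if i = l then X $ h $ l else 0)" for i
  proof -
    have "(\<Sum>j\<in>UNIV. check_A h l $ i $ j * X $ j $ i) =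
      (\<Sum>j\<in>UNIV. (if j = l then (if i = h then X $ l $ h else 0) else 0)
        + (if j = h then (if i = l then X $ h $ l else 0) else 0))"
      using assms by (intro sum.cong) (auto simp: check_A_def)
    then show ?thesis by (simp add: sum.distrib)
  qed
  then show ?thesis by (simp add: trace_matrix_mult sum.distrib)
qed

lemma trace_hat_A:
  assumes "ix1 < k"
  shows "trace (hat_A k ** X) = X $ ix1 $ ix1 - X $ k $ k"
proof -
  have "(\<Sum>j\<in>UNIV. hat_A k $ i $ j * X $ j $ i) =
    (if i = ix1 then X $ ix1 $ ix1 else 0) - (if i = k then X $ k $ k else 0)" for i
  proof -
    have "(\<Sum>j\<in>UNIV. hat_A k $ i $ j * X $ j $ i) =
      (\<Sum>j\<in>UNIV. (if j = ix1 then (if i = ix1 then X $ ix1 $ ix1 else 0) else 0)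
        - (if j = k then (if i = k then X $ k $ k else 0) else 0))"
      using assms by (intro sum.cong) (auto simp: hat_A_def)
    then show ?thesis by (simp add: sum_subtractf)
  qed
  then show ?thesis by (simp add: trace_matrix_mult sum_subtractf)
qed

text \<open>An arrow matrix satisfies the \<open>check_A\<close> and \<open>hat_A\<close>
  constraints automatically; the others translate by \<open>trace_arw_data_Arw\<close> and
  \<open>psd_Arw_iff\<close>.\<close>

lemma Arw_sdo_primal_feasible_iff:
  "Arw x \<in> sdo_primal_feasible A b \<longleftrightarrow> x \<in> soco_primal_feasible A b"
  by (auto simp: sdo_primal_feasible_def soco_primal_feasible_def trace_arw_data_Arw
      trace_check_A trace_hat_A ix_pairs_def psd_Arw_iff vec_eq_iff
      matrix_vector_mul_component)

text \<open>The \<open>hat_A\<close> constraints make the diagonal constant and, with symmetry, the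
  \<open>check_A\<close> constraints clear the block below the first row off its diagonal. The
  preimage is therefore the first row of \<open>X\<close>.\<close>

lemma sdo_primal_feasible_imp_Arw:
  assumes "X \<in> sdo_primal_feasible A b"
  obtains x where "X = Arw x"
proof
  have sym: "X $ j $ i = X $ i $ j" for i j
    using assms by (intro psd_symmetric) (simp add: sdo_primal_feasible_def)
  have less: "X $ h $ l = 0" if "ix1 < h" "h < l" for h l
  proof -
    have "trace (check_A h l ** X) = 0"
      using assms that by (auto simp: sdo_primal_feasible_def ix_pairs_def)
    then show ?thesis using that sym[of h l] by (simp add: trace_check_A)
  qed
  have diag: "X $ k $ k = X $ ix1 $ ix1" if "ix1 < k" for k
    using assms that trace_hat_A[OF that, of X] by (auto simp: sdo_primal_feasible_def)
  have off: "X $ i $ j = 0" if "ix1 < i" "ix1 < j" "i \<noteq> j" for i j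
    using that less[of i j] less[of j i] sym[of i j] by (cases i j rule: linorder_cases) auto
  have "X $ i $ j = Arw (X $ ix1) $ i $ j" for i j
    using diag[of i] off[of i j] sym[where i = ix1 and j = i]
    by (cases "i = ix1"; cases "j = ix1"; cases "i = j") (simp_all add: ix1_less_iff)
  then show "X = Arw (X $ ix1)"
    unfolding vec_eq_iff by blast
qed

section \<open>The dual constraint\<close>

lemma sum_scaleR_check_A_nth:
  "(\<Sum>(h, l)\<in>ix_pairs. w (h, l) *\<^sub>R check_A h l) $ i $ j =
     (if (i, j) \<in> ix_pairs then w (i, j) else if (j, i) \<in> ix_pairs then w (j, i) else 0)"
proof -
  have "(\<Sum>(h, l)\<in>ix_pairs. w (h, l) *\<^sub>R check_A h l) $ i $ j
    = (\<Sum>p\<in>ix_pairs. (if p = (i, j) then w (i, j) else 0) + (if p = (j, i) then w (j, i) else 0))"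
    unfolding sum_component
  proof (intro sum.cong refl)
    fix p :: "'a \<times> 'a"
    assume "p \<in> ix_pairs"
    then obtain h l where p: "p = (h, l)" and "h \<noteq> l"
      by (cases p) (auto simp: mem_ix_pairs)
    have "check_A h l $ i $ j = (if h = i \<and> l = j then 1 else 0) + (if h = j \<and> l = i then 1 else 0)"
      using \<open>h \<noteq> l\<close> by (cases "h = i \<and> l = j") (auto simp: check_A_def)
    moreover have "w (h, l) * (if h = a \<and> l = b then 1 else 0) = (if (h, l) = (a, b) then w (a, b) else 0)"
      for a b
      by simp
    ultimately show "(case p of (h, l) \<Rightarrow> w (h, l) *\<^sub>R check_A h l) $ i $ j =
        (if p = (i, j) then w (i, j) else 0) + (if p = (j, i) then w (j, i) else 0)"
      by (simp only: p prod.case vector_scaleR_component real_scaleR_def distrib_left)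
  qed
  also have "\<dots> = (if (i, j) \<in> ix_pairs then w (i, j) else 0) + (if (j, i) \<in> ix_pairs then w (j, i) else 0)"
    by (simp add: sum.distrib)
  \<comment> \<open>At most one of \<open>(i, j)\<close> and \<open>(j, i)\<close> lies in
    \<open>ix_pairs\<close>, so the two summands merge into one case distinction.\<close>
  finally show ?thesis
    by (auto simp: mem_ix_pairs)
qed

lemma sum_scaleR_hat_A_nth:
  "(\<Sum>k\<in>{ix1<..}. u k *\<^sub>R hat_A k) $ i $ j =
     (if i \<noteq> j then 0 else if i = ix1 then (\<Sum>k\<in>{ix1<..}. u k) else - u i)"
proof -
  have "(\<Sum>k\<in>{ix1<..}. u k *\<^sub>R hat_A k) $ i $ j =
    (\<Sum>k\<in>{ix1<..}. (if i = ix1 \<and> j = ix1 then u k else 0) - (if k = i then (if i = j then u i else 0) else 0))"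
    unfolding sum_component
    by (intro sum.cong) (auto simp: hat_A_def)
  then show ?thesis
    by (auto simp: sum_subtractf ix1_less_iff)
qed

text \<open>The entries of \<open>slack_matrix\<close> are chosen so that both multiplier sums
  cancel, leaving the equal shares on the diagonal and the halves in the first row and
  column.\<close>

lemma arw_data_eq_slack_matrix:
  "(\<Sum>(h, l)\<in>ix_pairs. w (h, l) *\<^sub>R check_A h l) + (\<Sum>k\<in>{ix1<..}. u k *\<^sub>R hat_A k)
     + slack_matrix s w u = arw_data s" (is "?W + ?U + _ = _")
proof -
  have "?W $ i $ j + ?U $ i $ j + slack_matrix s w u $ i $ j = arw_data s $ i $ j" for i j
    unfolding sum_scaleR_check_A_nth sum_scaleR_hat_A_nth mem_ix_pairs ix1_less_iff
    by (cases i j rule: linorder_cases; cases "i = ix1"; cases "j = ix1")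
      (simp_all add: slack_matrix_def arw_data_def Arw_def)
  then show ?thesis
    unfolding vec_eq_iff vector_add_component by blast
qed

lemma linear_arw_data: "linear arw_data"
  by (rule linearI) (auto simp: vec_eq_iff arw_data_def Arw_def algebra_simps add_divide_distrib)

lemma vector_matrix_mult_eq_sum: "v v* A = (\<Sum>i\<in>UNIV. v $ i *\<^sub>R A $ i)"
  for A :: "('m::finite, 'n::finite) rmat"
  by (simp add: vec_eq_iff vector_matrix_mult_def mult.commute)

text \<open>By linearity of \<open>arw_data\<close> the dual equation only involves the SOCO slack
  \<open>c - v v* A\<close>, where \<open>v v* A\<close> is A^T v; cancelling against
  \<open>arw_data_eq_slack_matrix\<close> then solves it for \<open>S\<close>.\<close>

lemma sdo_dual_feasible_iff:
  "(v, w, u, S) \<in> sdo_dual_feasible A c \<longleftrightarrow>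
     w \<in> extensional ix_pairs \<and> u \<in> extensional {ix1<..} \<and>
     S = slack_matrix (c - v v* A) w u \<and> psd S"
proof -
  let ?V = "\<Sum>i\<in>UNIV. v $ i *\<^sub>R arw_data (A $ i)"
    and ?W = "\<Sum>(h, l)\<in>ix_pairs. w (h, l) *\<^sub>R check_A h l"
    and ?U = "\<Sum>k\<in>{ix1<..}. u k *\<^sub>R hat_A k"
  let ?s = "c - v v* A"
  have "arw_data (v v* A) = ?V"
    unfolding vector_matrix_mult_eq_sum linear_sum[OF linear_arw_data] linear_cmul[OF linear_arw_data] ..
  then have "arw_data c = ?V + arw_data ?s"
    unfolding linear_diff[OF linear_arw_data] by simp
  then have "arw_data c = ?V + ?W + ?U + slack_matrix ?s w u"
    unfolding arw_data_eq_slack_matrix[symmetric, of ?s w u] by (simp only: add.assoc)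
  then have "?V + ?W + ?U + S = arw_data c \<longleftrightarrow> S = slack_matrix ?s w u"
    by (simp only: add_left_cancel)
  then show ?thesis
    unfolding sdo_dual_feasible_def mem_Collect_eq prod.case by (simp only:)
qed

section \<open>The two mappings are inverse and admissible\<close>

lemma sdo_to_soco_eq:
  "sdo_to_soco A c (Arw x, v, w, u, S) = (x, v, c - v v* A)"
  by (simp add: sdo_to_soco_def inv_f_f[OF inj_Arw] vector_matrix_mult_eq_sum vec_eq_iff)

theorem theorem4p1:
  fixes A :: "real ^ 'n::{finite,linorder} ^ 'm::finite"
    and b :: "real ^ 'm"
    and c :: "real ^ 'n::{finite,linorder}"
  shows "inverse_mapping
           (soco_primal_feasible A b \<times> soco_dual_feasible A c)
           (sdo_primal_feasible A b \<times> sdo_dual_feasible A c)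
           soco_to_sdo (sdo_to_soco A c)
       \<and> admissible
           (soco_primal_feasible A b) (soco_dual_feasible A c)
           (\<lambda>x. c \<bullet> x) (\<lambda>(y, s). b \<bullet> y)
           (sdo_primal_feasible A b) (sdo_dual_feasible A c)
           (\<lambda>X. trace (arw_data c ** X)) (\<lambda>(v, w, u, S). b \<bullet> v)
           soco_to_sdo (sdo_to_soco A c)"
proof -
  let ?F = "soco_primal_feasible A b \<times> soco_dual_feasible A c"
  let ?G = "sdo_primal_feasible A b \<times> sdo_dual_feasible A c"
  let ?M = "soco_to_sdo :: _ \<Rightarrow> (_ \<times> ('m, 'n) sdo_dual) set" and ?N = "sdo_to_soco A c"
  \<comment> \<open>\<open>?N\<close> recomputes the slack from \<open>c\<close> and the dual
    vector, which returns \<open>s\<close> because dual feasibility already determines it.\<close>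
  have forward: "Z \<in> ?G \<and> ?N Z = z" if zF: "z \<in> ?F" and ZM: "Z \<in> ?M z" for z Z
  proof -
    obtain x y s where z: "z = (x, y, s)" by (cases z)
    have feasible: "x \<in> soco_primal_feasible A b" "s = c - y v* A"
      using zF by (auto simp: z soco_dual_feasible_def)
    obtain w u S where Z: "Z = (Arw x, y, w, u, S)" "w \<in> extensional ix_pairs"
      "u \<in> extensional {ix1<..}" "S = slack_matrix s w u" "psd S"
      using ZM unfolding z soco_to_sdo_def by blast
    have "Arw x \<in> sdo_primal_feasible A b"
      using feasible by (simp only: Arw_sdo_primal_feasible_iff)
    moreover have "(y, w, u, S) \<in> sdo_dual_feasible A c"
      using Z feasible by (simp only: sdo_dual_feasible_iff)
    moreover have "?N Z = z"
      by (simp only: Z(1) z sdo_to_soco_eq feasible)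
    ultimately show ?thesis by (simp add: Z(1))
  qed
  \<comment> \<open>Without this the image of \<open>?M z\<close> under \<open>?N\<close> could be
    empty instead of \<open>{z}\<close>.\<close>
  have nonempty: "?M z \<noteq> {}" if "z \<in> ?F" for z
  proof -
    obtain x y s where z: "z = (x, y, s)" by (cases z)
    have "s \<in> lorentz_cone"
      using that by (auto simp: z soco_dual_feasible_def)
    then obtain w u where "w \<in> extensional ix_pairs" "u \<in> extensional {ix1<..}" "psd (slack_matrix s w u)"
      by (rule lorentz_cone_imp_psd_slack_matrix)
    then have "(Arw x, y, w, u, slack_matrix s w u) \<in> ?M z"
      by (simp add: z soco_to_sdo_def)
    then show ?thesis by blast
  qed
  have backward: "?N Z \<in> ?F \<and> Z \<in> ?M (?N Z)" if Z: "Z \<in> ?G" for Z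
  proof -
    obtain X v w u S where Zeq: "Z = (X, v, w, u, S)" by (cases Z)
    obtain x where X: "X = Arw x"
      using Z sdo_primal_feasible_imp_Arw[of X A b] by (auto simp: Zeq)
    have x: "x \<in> soco_primal_feasible A b"
      using Z by (simp add: Zeq X Arw_sdo_primal_feasible_iff)
    have S: "w \<in> extensional ix_pairs" "u \<in> extensional {ix1<..}"
      "S = slack_matrix (c - v v* A) w u" "psd S"
      using Z unfolding Zeq mem_Times_iff fst_conv snd_conv sdo_dual_feasible_iff by blast+
    \<comment> \<open>Trace and first row of \<open>S\<close> reveal the slack whatever the
      multipliers are, so positive semidefiniteness puts it into the cone.\<close>
    then have "c - v v* A \<in> lorentz_cone"
      by (intro psd_imp_lorentz_cone[of S]) simp_all
    then have "(v, c - v v* A) \<in> soco_dual_feasible A c"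
      by (simp add: soco_dual_feasible_def)
    moreover have N: "?N Z = (x, v, c - v v* A)"
      by (simp only: Zeq X sdo_to_soco_eq)
    moreover have "Z \<in> ?M (x, v, c - v v* A)"
      using S unfolding soco_to_sdo_def Zeq X by blast
    ultimately show ?thesis
      unfolding N using x by blast
  qed
  have objective: "c \<bullet> fst z = trace (arw_data c ** fst Z) \<and>
      (\<lambda>(y, s). b \<bullet> y) (snd z) = (\<lambda>(v, w, u, S). b \<bullet> v) (snd Z)"
    if "Z \<in> ?M z" for z Z
    using that by (auto simp: soco_to_sdo_def trace_arw_data_Arw)
  have "inverse_mapping ?F ?G ?M ?N"
    unfolding inverse_mapping_def
  proof (intro conjI ballI)
    show "?N ` ?M z = {z}" if "z \<in> ?F" for z
      using forward[OF that] nonempty[OF that] by blast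
    show "Z \<in> ?M (?N Z)" if "Z \<in> ?G" for Z
      using backward[OF that] by (rule conjunct2)
  qed
  moreover have "admissible (soco_primal_feasible A b) (soco_dual_feasible A c)
           (\<lambda>x. c \<bullet> x) (\<lambda>(y, s). b \<bullet> y)
           (sdo_primal_feasible A b) (sdo_dual_feasible A c)
           (\<lambda>X. trace (arw_data c ** X)) (\<lambda>(v, w, u, S). b \<bullet> v) ?M ?N"
    unfolding admissible_def
  proof (intro conjI ballI impI)
    show "?M z \<subseteq> ?G" if "z \<in> ?F" for z
      using forward[OF that] by blast
    show "?N Z \<in> ?F" if "Z \<in> ?G" for Z
      using backward[OF that] by (rule conjunct1)
    fix z Z
    assume "Z \<in> ?G" "Z \<in> ?M z \<or> z = ?N Z"
    \<comment> \<open>Correspondence through \<open>?N\<close> reduces to correspondence through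
      \<open>?M\<close>.\<close>
    then have "Z \<in> ?M z"
      using backward by blast
    then show "c \<bullet> fst z = trace (arw_data c ** fst Z)"
      and "(\<lambda>(y, s). b \<bullet> y) (snd z) = (\<lambda>(v, w, u, S). b \<bullet> v) (snd Z)"
      using objective by simp_all
  qed
  ultimately show ?thesis by blast
qed

end
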